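(* Let $z=(z_t)_{t=0}^T$ be an adapted policy. Then the process $$v_t(x_{1:t}):=\mathcal R_{\mathcal S_{t+1:T}}\Bigl(Q\bigl(z_{0:t}(x_{1:t}),z_{t+1:T}(x_{1:t},\cdot);x_{1:t},\cdot\bigr)\mid x_{1:t}\Bigr),\qquad t=0,\dots,T,$$ is an $\mathcal R$-martingale with terminal value $v_T=Q\bigl(z_{0:T}(\cdot);\cdot\bigr)$.
   Context: Spaces: $T\ge1$; $\Xi_t$, $t=1,\dots,T$, are Polish spaces; $\Xi=\Xi_{1:T}:=\Xi_1\times\dots\times\Xi_T$, elements $x_{1:T}=(x_1,\dots,x_T)$, $x_{1:t}=(x_1,\dots,x_t)$, $x_{1:0}$ the empty tuple; $P$ is a Borel probability measure on $\Xi$; $\mathcal F_t$ is the sigma algebra generated by $x\mapsto x_{1:t}$, $\mathcal F_0$ trivial; $P(\cdot\mid x_{1:t})$ is the regular conditional probability on $\Xi_{t+1}\times\dots\times\Xi_T$ given the first $t$ coordinates. Risk functionals: a distortion function is a nondecreasing $\sigma\colon[0,1)\to[0,\infty)$ with $\int_0^1\sigma(u)\,du=1$. For $\alpha\in[0,1)$, $\mathsf{AV@R}_{\alpha;P}(Y):=\inf_{c\in\mathbb R}\{c+\frac1{1-\alpha}\mathbb E_P(Y-c)_+\}$, and $$\mathcal R_{\sigma;P}(Y):=\sup\Big\{\mathbb E_P Y\zeta:\ \zeta\ge0,\ \mathbb E_P\zeta=1,\ \mathsf{AV@R}_{\alpha;P}(\zeta)\le\tfrac1{1-\alpha}\int_\alpha^1\sigma(u)\,du\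 \text{ for all }\alpha\in(0,1)\Big\}.$$ $\mathcal S_1,\dots,\mathcal S_T$ are collections of distortion functions. The conditional risk measure is $\mathcal R_{\mathcal S_{t+1}}(Y\mid x_{1:t}):=\sup_{\sigma\in\mathcal S_{t+1}}\mathcal R_{\sigma;P(\cdot\mid x_{1:t})}(Y(x_{1:t},\cdot))$, and for $s<t$ the nested risk functional is $$\mathcal R_{\mathcal S_{s+1:t}}(Y\mid x_{1:s}):=\mathcal R_{\mathcal S_{s+1}}\bigl(\dots\mathcal R_{\mathcal S_{t-1}}\bigl(\mathcal R_{\mathcal S_t}(Y\mid x_{1:t-1})\mid x_{1:t-2}\bigr)\dots\mid x_{1:s}\bigr);$$ $\mathcal R_{\mathcal S_{T+1:T}}$ is the identity. Random variables are assumed to be such that the risk functionals are well defined. Policies: $\mathcal Z_{0:T}=\mathcal Z_0\times\dots\times\mathcal Z_T$ is the set of decisions; a policy $z=(z_t)_{t=0}^T$, $z_t\colon\Xi\to\mathcal Z_t$, is adapted if each $z_t$ is $\mathcal F_t$-measurable, i.e. $z_t=z_t(x_{1:t})$. $Q\colon\mathcal Z_{0:T}\times\Xi_{1:T}\to\mathbb R\cup\{\infty\}$ is a lower semi-continuous cost function, written $Q(z;x)$; the symbol "$\cdot$" indicates the random component. A stochastic process $(v_t)_{t=0}^T$ is an $\mathcal R$-martingale if $v_t(x_{1:t})=\mathcal R_{\mathcal S_{t+1}}(v_{t+1}\mid x_{1:t})$ a.s. for every $t\in\{0,\dots,T-1\}$. *)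

theory Defs
  imports "HOL-Probability.Probability"
begin

section \<open>Spaces, filtration, policies\<close>

definition Polish_space :: "'a topology \<Rightarrow> bool" where
  "Polish_space X \<longleftrightarrow> completely_metrizable_space X \<and> separable_space X"

definition borel_of :: "'a topology \<Rightarrow> 'a measure" where
  "borel_of X = sigma (topspace X) {U. openin X U}"

definition lower_semicontinuous_on_top :: "'a topology \<Rightarrow> ('a \<Rightarrow> ereal) \<Rightarrow> bool" where
  "lower_semicontinuous_on_top X f \<longleftrightarrow> (\<forall>a. openin X {x \<in> topspace X. a < f x})"

text \<open>
  The spaces \<open>\<Xi>\<^sub>1, \<dots>, \<Xi>\<^sub>T\<close> are topologies \<open>\<Xi> 1, \<dots>, \<Xi> T\<close> whose carriers are arbitrary subsets of one
  type. A tuple \<open>x\<^bsub>m:n\<^esub>\<close> is a function that is \<open>undefined\<close> outside \<open>{m..n}\<close>; the prefix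
  \<open>x\<^bsub>1:t\<^esub>\<close> of \<open>x\<close> is \<open>restrict x {1..t}\<close>.
\<close>

definition path_space :: "(nat \<Rightarrow> 'a topology) \<Rightarrow> nat \<Rightarrow> nat \<Rightarrow> (nat \<Rightarrow> 'a) topology" where
  "path_space \<Xi> m n = product_topology \<Xi> {m..n}"

definition paste :: "nat \<Rightarrow> nat \<Rightarrow> (nat \<Rightarrow> 'a) \<Rightarrow> (nat \<Rightarrow> 'a) \<Rightarrow> (nat \<Rightarrow> 'a)" where
  "paste T t x y = merge {1..t} {Suc t..T} (x, y)"

definition history :: "(nat \<Rightarrow> 'a topology) \<Rightarrow> nat \<Rightarrow> nat \<Rightarrow> (nat \<Rightarrow> 'a) measure" where
  "history \<Xi> T t =
     vimage_algebra (topspace (path_space \<Xi> 1 T)) (\<lambda>x. restrict x {1..t}) (borel_of (path_space \<Xi> 1 t))"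

text \<open>
  The second conjunct is the reading \<open>z\<^sub>t = z\<^sub>t(x\<^bsub>1:t\<^esub>)\<close> of adaptedness. It follows from the first one
  as soon as the topology \<open>\<Z> t\<close> is T0, which is not required here.
\<close>

definition adapted_policy ::
  "(nat \<Rightarrow> 'a topology) \<Rightarrow> (nat \<Rightarrow> 'z topology) \<Rightarrow> nat \<Rightarrow> (nat \<Rightarrow> (nat \<Rightarrow> 'a) \<Rightarrow> 'z) \<Rightarrow> bool" where
  "adapted_policy \<Xi> \<Z> T z \<longleftrightarrow>
     (\<forall>t\<le>T. z t \<in> history \<Xi> T t \<rightarrow>\<^sub>M borel_of (\<Z> t) \<and>
        (\<forall>x \<in> topspace (path_space \<Xi> 1 T). \<forall>x' \<in> topspace (path_space \<Xi> 1 T).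
           restrict x {1..t} = restrict x' {1..t} \<longrightarrow> z t x = z t x'))"

definition regular_cond_prob ::
  "(nat \<Rightarrow> 'a topology) \<Rightarrow> nat \<Rightarrow> (nat \<Rightarrow> 'a) measure \<Rightarrow> nat \<Rightarrow> ((nat \<Rightarrow> 'a) \<Rightarrow> (nat \<Rightarrow> 'a) measure) \<Rightarrow> bool" where
  "regular_cond_prob \<Xi> T P t \<kappa> \<longleftrightarrow>
     \<kappa> \<in> borel_of (path_space \<Xi> 1 t) \<rightarrow>\<^sub>M prob_algebra (borel_of (path_space \<Xi> (Suc t) T)) \<and>
     (\<forall>A \<in> sets (borel_of (path_space \<Xi> 1 t)). \<forall>B \<in> sets (borel_of (path_space \<Xi> (Suc t) T)).
        emeasure P {x \<in> space P. restrict x {1..t} \<in> A \<and> restrict x {Suc t..T} \<in> B} =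
        (\<integral>\<^sup>+x. indicator A (restrict x {1..t}) * emeasure (\<kappa> (restrict x {1..t})) B \<partial>P))"

section \<open>Distortion risk functionals\<close>

text \<open>
  Expectation of an extended real random variable, as positive part minus negative part. When both
  parts are infinite the value is meaningless; \<open>has_expectation\<close> excludes this case.
\<close>

definition expectation_ereal :: "'b measure \<Rightarrow> ('b \<Rightarrow> ereal) \<Rightarrow> ereal" where
  "expectation_ereal M Y =
     enn2ereal (\<integral>\<^sup>+x. e2ennreal (Y x) \<partial>M) - enn2ereal (\<integral>\<^sup>+x. e2ennreal (- Y x) \<partial>M)"

definition has_expectation :: "'b measure \<Rightarrow> ('b \<Rightarrow> ereal) \<Rightarrow> bool" where
  "has_expectation M Y \<longleftrightarrow> Y \<in> borel_measurable M \<and>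
     ((\<integral>\<^sup>+x. e2ennreal (Y x) \<partial>M) < \<infinity> \<or> (\<integral>\<^sup>+x. e2ennreal (- Y x) \<partial>M) < \<infinity>)"

definition AVaR :: "'b measure \<Rightarrow> real \<Rightarrow> ('b \<Rightarrow> ereal) \<Rightarrow> ereal" where
  "AVaR M \<alpha> Y =
     (INF c::real. ereal c + ereal (1 / (1 - \<alpha>)) * expectation_ereal M (\<lambda>x. max 0 (Y x - ereal c)))"

text \<open>
  A distortion function is only used on \<open>[0,1)\<close>. The integral condition entails integrability, because
  the integral of a function that is not integrable is \<open>0\<close>.
\<close>

definition distortion :: "(real \<Rightarrow> real) \<Rightarrow> bool" where
  "distortion \<sigma> \<longleftrightarrow> mono_on {0..<1} \<sigma> \<and> (\<forall>u\<in>{0..<1}. 0 \<le> \<sigma> u) \<and> (LINT u:{0..<1}|lborel. \<sigma> u) = 1"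

definition dual_densities :: "'b measure \<Rightarrow> (real \<Rightarrow> real) \<Rightarrow> ('b \<Rightarrow> real) set" where
  "dual_densities M \<sigma> = {\<zeta> \<in> borel_measurable M.
     (\<forall>x\<in>space M. 0 \<le> \<zeta> x) \<and> expectation_ereal M (\<lambda>x. ereal (\<zeta> x)) = 1 \<and>
     (\<forall>\<alpha>\<in>{0<..<1}. AVaR M \<alpha> (\<lambda>x. ereal (\<zeta> x)) \<le> ereal (1 / (1 - \<alpha>) * (LINT u:{\<alpha>..<1}|lborel. \<sigma> u)))}"

definition risk :: "'b measure \<Rightarrow> (real \<Rightarrow> real) \<Rightarrow> ('b \<Rightarrow> ereal) \<Rightarrow> ereal" where
  "risk M \<sigma> Y = (SUP \<zeta>\<in>dual_densities M \<sigma>. expectation_ereal M (\<lambda>x. Y x * ereal (\<zeta> x)))"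

definition risk_well_defined :: "'b measure \<Rightarrow> (real \<Rightarrow> real) \<Rightarrow> ('b \<Rightarrow> ereal) \<Rightarrow> bool" where
  "risk_well_defined M \<sigma> Y \<longleftrightarrow> (\<forall>\<zeta>\<in>dual_densities M \<sigma>. has_expectation M (\<lambda>x. Y x * ereal (\<zeta> x)))"

section \<open>Conditional and nested risk functionals\<close>

text \<open>
  \<open>\<kappa> t\<close> stands for \<open>P(\<cdot> | x\<^bsub>1:t\<^esub>)\<close> and \<open>S t\<close> for the collection of distortion functions at stage \<open>t\<close>.
  Random variables, conditional risks included, are functions of the whole path \<open>x\<close>; the conditional
  risk at \<open>t\<close> uses \<open>x\<close> only through \<open>x\<^bsub>1:t\<^esub>\<close>.
\<close>

definition cond_risk ::
  "nat \<Rightarrow> (nat \<Rightarrow> (nat \<Rightarrow> 'a) \<Rightarrow> (nat \<Rightarrow> 'a) measure) \<Rightarrow> (nat \<Rightarrow> (real \<Rightarrow> real) set) \<Rightarrow> nat \<Rightarrow>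
   ((nat \<Rightarrow> 'a) \<Rightarrow> ereal) \<Rightarrow> (nat \<Rightarrow> 'a) \<Rightarrow> ereal" where
  "cond_risk T \<kappa> S t Y x =
     (SUP \<sigma>\<in>S (Suc t). risk (\<kappa> t (restrict x {1..t})) \<sigma> (\<lambda>y. Y (paste T t x y)))"

text \<open>
  \<open>nested_risk T \<kappa> S s t Y\<close> is \<open>\<R>\<^bsub>S s+1:t\<^esub>(Y | x\<^bsub>1:s\<^esub>)\<close>, i.e. the composition
  \<open>cond_risk s (cond_risk (s+1) (\<dots> (cond_risk (t-1) Y)))\<close>, and the identity for \<open>s = t\<close>.
\<close>

definition nested_risk ::
  "nat \<Rightarrow> (nat \<Rightarrow> (nat \<Rightarrow> 'a) \<Rightarrow> (nat \<Rightarrow> 'a) measure) \<Rightarrow> (nat \<Rightarrow> (real \<Rightarrow> real) set) \<Rightarrow> nat \<Rightarrow> nat \<Rightarrow>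
   ((nat \<Rightarrow> 'a) \<Rightarrow> ereal) \<Rightarrow> (nat \<Rightarrow> 'a) \<Rightarrow> ereal" where
  "nested_risk T \<kappa> S s t Y = foldr (cond_risk T \<kappa> S) [s..<t] Y"

text \<open>
  The standing assumption that the risk functionals are well defined: the argument of each of the
  nested conditional risk measures is a random variable on \<open>\<Xi>\<close>, and the expectations that enter
  the conditional risk measure exist almost surely.
\<close>

definition nested_risk_well_defined ::
  "(nat \<Rightarrow> 'a topology) \<Rightarrow> nat \<Rightarrow> (nat \<Rightarrow> 'a) measure \<Rightarrow> (nat \<Rightarrow> (nat \<Rightarrow> 'a) \<Rightarrow> (nat \<Rightarrow> 'a) measure) \<Rightarrow>
   (nat \<Rightarrow> (real \<Rightarrow> real) set) \<Rightarrow> nat \<Rightarrow> nat \<Rightarrow> ((nat \<Rightarrow> 'a) \<Rightarrow> ereal) \<Rightarrow> bool" where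
  "nested_risk_well_defined \<Xi> T P \<kappa> S s t Y \<longleftrightarrow>
     (\<forall>r\<in>{s..<t}.
        nested_risk T \<kappa> S (Suc r) t Y \<in> borel_measurable (borel_of (path_space \<Xi> 1 T)) \<and>
        (AE x in P. \<forall>\<sigma>\<in>S (Suc r).
           risk_well_defined (\<kappa> r (restrict x {1..r})) \<sigma>
             (\<lambda>y. nested_risk T \<kappa> S (Suc r) t Y (paste T r x y))))"

text \<open>
  The first conjunct says that \<open>v\<close> is a stochastic process of the form \<open>v\<^sub>t = v\<^sub>t(x\<^bsub>1:t\<^esub>)\<close>.
\<close>

definition risk_martingale ::
  "(nat \<Rightarrow> 'a topology) \<Rightarrow> nat \<Rightarrow> (nat \<Rightarrow> 'a) measure \<Rightarrow> (nat \<Rightarrow> (nat \<Rightarrow> 'a) \<Rightarrow> (nat \<Rightarrow> 'a) measure) \<Rightarrow>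
   (nat \<Rightarrow> (real \<Rightarrow> real) set) \<Rightarrow> (nat \<Rightarrow> (nat \<Rightarrow> 'a) \<Rightarrow> ereal) \<Rightarrow> bool" where
  "risk_martingale \<Xi> T P \<kappa> S v \<longleftrightarrow>
     (\<forall>t\<le>T. v t \<in> borel_measurable (history \<Xi> T t)) \<and>
     (\<forall>t<T. AE x in P. v t x = cond_risk T \<kappa> S t (v (Suc t)) x)"

section \<open>The value process of a policy\<close>

definition policy_cost ::
  "nat \<Rightarrow> ((nat \<Rightarrow> 'z) \<Rightarrow> (nat \<Rightarrow> 'a) \<Rightarrow> ereal) \<Rightarrow> (nat \<Rightarrow> (nat \<Rightarrow> 'a) \<Rightarrow> 'z) \<Rightarrow> (nat \<Rightarrow> 'a) \<Rightarrow> ereal" where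
  "policy_cost T Q z x = Q (\<lambda>s\<in>{0..T}. z s x) x"

text \<open>
  The random variable \<open>Q(z\<^bsub>0:t\<^esub>(x\<^bsub>1:t\<^esub>), z\<^bsub>t+1:T\<^esub>(x\<^bsub>1:t\<^esub>,\<cdot>); x\<^bsub>1:t\<^esub>,\<cdot>)\<close> as a function of \<open>y\<close>, which
  enters through its components \<open>t+1, \<dots>, T\<close>.
\<close>

definition frozen_cost ::
  "nat \<Rightarrow> ((nat \<Rightarrow> 'z) \<Rightarrow> (nat \<Rightarrow> 'a) \<Rightarrow> ereal) \<Rightarrow> (nat \<Rightarrow> (nat \<Rightarrow> 'a) \<Rightarrow> 'z) \<Rightarrow> nat \<Rightarrow> (nat \<Rightarrow> 'a) \<Rightarrow>
   (nat \<Rightarrow> 'a) \<Rightarrow> ereal" where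
  "frozen_cost T Q z t x y =
     Q (\<lambda>s\<in>{0..T}. if s \<le> t then z s x else z s (paste T t x y)) (paste T t x y)"

definition value_process ::
  "nat \<Rightarrow> (nat \<Rightarrow> (nat \<Rightarrow> 'a) \<Rightarrow> (nat \<Rightarrow> 'a) measure) \<Rightarrow> (nat \<Rightarrow> (real \<Rightarrow> real) set) \<Rightarrow>
   ((nat \<Rightarrow> 'z) \<Rightarrow> (nat \<Rightarrow> 'a) \<Rightarrow> ereal) \<Rightarrow> (nat \<Rightarrow> (nat \<Rightarrow> 'a) \<Rightarrow> 'z) \<Rightarrow> nat \<Rightarrow> (nat \<Rightarrow> 'a) \<Rightarrow> ereal" where
  "value_process T \<kappa> S Q z t x = nested_risk T \<kappa> S t T (frozen_cost T Q z t x) x"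

end

theory Submission
  imports Defs
begin

text \<open>
  The martingale property is the recursion that defines the nested risk functional, once two readings
  of the value process have been identified. By definition \<open>v\<^sub>t(x)\<close> nests the risk of the cost
  in which the decisions up to \<open>t\<close> are frozen at those taken along \<open>x\<close>; the cost therefore
  changes with \<open>t\<close> and \<open>x\<close>, whereas the recursion compares nested risks of one fixed
  random variable.

  The two facts that close the gap are locality and adaptedness. Locality
  (\<open>nested_risk_cong\<close>): the nested risk at \<open>(t, x)\<close> sees its argument only at paths that share the
  prefix \<open>x\<^bsub>1:t\<^esub>\<close>. Adaptedness (\<open>frozen_cost_eq_policy_cost\<close>): at such paths, freezing the first
  decisions changes nothing, as they are determined by the common prefix. Hence on \<open>\<Xi>\<close>
  the value \<open>v\<^sub>t\<close> is the nested risk of the single random variable \<open>policy_cost\<close>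
  (\<open>value_process_eq_nested_risk\<close>), and \<open>v\<^sub>t = \<R>(v\<^bsub>t+1\<^esub> | \<cdot>)\<close> holds at every path, not only
  almost surely.

  Being a process takes one more argument: that \<open>v\<^sub>t\<close> is Borel on \<open>\<Xi>\<close> is part of
  the assumption that the risks are well defined (for \<open>t \<ge> 1\<close>), and locality shows that it depends on
  \<open>x\<^bsub>1:t\<^esub>\<close> alone. A Borel function of this kind is measurable for the history up to \<open>t\<close>
  (\<open>measurable_history_of_prefix\<close>): continue every prefix by the tail of one fixed path. The initial
  value \<open>v\<^sub>0\<close> is constant.
\<close>

section \<open>Borel sets, paths and prefixes\<close>

(* Prefixes are indexed by {1..t}; rewriting 1 to Suc 0 would hide them from the rules below. *)
declare One_nat_def [simp del]

lemma space_borel_of [simp]: "space (borel_of X) = topspace X"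
  unfolding borel_of_def by (rule space_measure_of) (auto dest: openin_subset)

lemma continuous_map_measurable_borel_of:
  assumes "continuous_map X Y f"
  shows "f \<in> borel_of X \<rightarrow>\<^sub>M borel_of Y"
proof -
  have "f \<in> borel_of X \<rightarrow>\<^sub>M sigma (topspace Y) {U. openin Y U}"
  proof (rule measurable_measure_of)
    show "f \<in> space (borel_of X) \<rightarrow> topspace Y"
      using assms by (auto simp: continuous_map_def)
    fix U assume "U \<in> {U. openin Y U}"
    then have "openin X {x \<in> topspace X. f x \<in> U}"
      using assms by (auto simp: continuous_map_def)
    moreover have "f -` U \<inter> space (borel_of X) = {x \<in> topspace X. f x \<in> U}"
      by auto
    ultimately show "f -` U \<inter> space (borel_of X) \<in> sets (borel_of X)"
      by (auto simp: borel_of_def intro: sigma_sets.Basic dest: openin_subset)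
  qed (auto dest: openin_subset)
  then show ?thesis by (simp add: borel_of_def)
qed

lemma topspace_path_space: "topspace (path_space \<Xi> m n) = (\<Pi>\<^sub>E i\<in>{m..n}. topspace (\<Xi> i))"
  by (simp add: path_space_def topspace_product_topology)

lemma restrict_path:
  assumes "x \<in> topspace (path_space \<Xi> 1 T)" "t \<le> T"
  shows "restrict x {1..t} \<in> topspace (path_space \<Xi> 1 t)"
  using assms by (auto simp: topspace_path_space PiE_iff)

lemma paste_path:
  assumes "x \<in> topspace (path_space \<Xi> 1 t)" "y \<in> topspace (path_space \<Xi> (Suc t) T)" "t \<le> T"
  shows "paste T t x y \<in> topspace (path_space \<Xi> 1 T)"
  using assms by (auto simp: topspace_path_space paste_def merge_def PiE_iff extensional_def)

lemma paste_restrict [simp]: "paste T t (restrict x {1..t}) y = paste T t x y"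
  by (auto simp: paste_def merge_def fun_eq_iff)

lemma paste_prefix_cong:
  assumes "restrict x {1..t} = restrict x' {1..t}"
  shows "paste T t x y = paste T t x' y"
  using arg_cong[OF assms, of "\<lambda>w. paste T t w y"] by simp

lemma paste_restrict_tail [simp]: "paste T t x (restrict y {Suc t..T}) = paste T t x y"
  by (auto simp: paste_def merge_def fun_eq_iff)

lemma restrict_paste [simp]: "restrict (paste T t x y) {1..t} = restrict x {1..t}"
  by (auto simp: paste_def merge_def fun_eq_iff)

lemma paste_self:
  assumes "x \<in> topspace (path_space \<Xi> 1 T)" "t \<le> T"
  shows "paste T t x x = x"
  using assms by (auto simp: topspace_path_space paste_def merge_def PiE_iff extensional_def fun_eq_iff)

lemma restrict_prefix_mono:
  fixes s t :: nat
  assumes "restrict x {1..t} = restrict y {1..t}" "s \<le> t"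
  shows "restrict x {1..s} = restrict y {1..s}"
proof
  fix i
  show "restrict x {1..s} i = restrict y {1..s} i"
    using fun_cong[OF assms(1), of i] assms(2) by (auto simp: restrict_def split: if_splits)
qed

lemma continuous_map_paste:
  assumes "a \<in> topspace (path_space \<Xi> 1 T)" "t \<le> T"
  shows "continuous_map (path_space \<Xi> 1 t) (path_space \<Xi> 1 T) (\<lambda>w. paste T t w a)"
  unfolding path_space_def continuous_map_componentwise
proof (intro conjI ballI)
  show "(\<lambda>w. paste T t w a) ` topspace (product_topology \<Xi> {1..t}) \<subseteq> extensional {1..T}"
    using assms(2) by (auto simp: paste_def merge_def extensional_def)
next
  fix i assume i: "i \<in> {1..T}"
  show "continuous_map (product_topology \<Xi> {1..t}) (\<Xi> i) (\<lambda>w. paste T t w a i)"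
  proof (cases "i \<le> t")
    case True
    then have "(\<lambda>w. paste T t w a i) = (\<lambda>w. w i)"
      using i by (auto simp: paste_def merge_def)
    then show ?thesis
      using i True by (simp add: continuous_map_product_projection)
  next
    case False
    then have "(\<lambda>w. paste T t w a i) = (\<lambda>w. a i)"
      using i by (auto simp: paste_def merge_def)
    then show ?thesis
      using i assms(1) by (auto simp: topspace_path_space PiE_iff)
  qed
qed

text \<open>
  If \<open>f\<close> depends on the prefix alone, then \<open>f(x) = f(x\<^bsub>1:t\<^esub>, a\<^bsub>t+1:T\<^esub>)\<close> for any fixed path \<open>a\<close>,
  and continuing a prefix by the tail of \<open>a\<close> is continuous. This exhibits \<open>f\<close> as a measurable function
  of the prefix.
\<close>

lemma measurable_history_of_prefix:
  assumes f: "f \<in> borel_of (path_space \<Xi> 1 T) \<rightarrow>\<^sub>M N"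
    and t: "t \<le> T"
    and prefix: "\<And>x x'. x \<in> topspace (path_space \<Xi> 1 T) \<Longrightarrow> x' \<in> topspace (path_space \<Xi> 1 T) \<Longrightarrow>
      restrict x {1..t} = restrict x' {1..t} \<Longrightarrow> f x = f x'"
  shows "f \<in> history \<Xi> T t \<rightarrow>\<^sub>M N"
proof (cases "topspace (path_space \<Xi> 1 T) = {}")
  case True
  then show ?thesis
    by (simp add: history_def measurable_def)
next
  case False
  then obtain a where a: "a \<in> topspace (path_space \<Xi> 1 T)" by blast
  have "(\<lambda>x. restrict x {1..t}) \<in> history \<Xi> T t \<rightarrow>\<^sub>M borel_of (path_space \<Xi> 1 t)"
    unfolding history_def
    by (rule measurable_vimage_algebra1) (use restrict_path[OF _ t] in auto)
  from measurable_compose[OF measurable_compose[OF this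
        continuous_map_measurable_borel_of[OF continuous_map_paste[OF a t]]] f]
  have "(\<lambda>x. f (paste T t x a)) \<in> history \<Xi> T t \<rightarrow>\<^sub>M N"
    by simp
  moreover have "f (paste T t x a) = f x" if x: "x \<in> space (history \<Xi> T t)" for x
  proof (rule prefix)
    show x': "x \<in> topspace (path_space \<Xi> 1 T)"
      using x by (simp add: history_def)
    have "restrict a {Suc t..T} \<in> topspace (path_space \<Xi> (Suc t) T)"
      using a by (auto simp: topspace_path_space PiE_iff)
    from paste_path[OF restrict_path[OF x' t] this t]
    show "paste T t x a \<in> topspace (path_space \<Xi> 1 T)"
      by simp
  qed simp
  ultimately show ?thesis
    by (subst measurable_cong[where g="\<lambda>x. f (paste T t x a)"]) simp_all
qed

section \<open>Locality of the risk functionals\<close>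

lemma expectation_ereal_cong:
  assumes "\<And>x. x \<in> space M \<Longrightarrow> Y x = Y' x"
  shows "expectation_ereal M Y = expectation_ereal M Y'"
  unfolding expectation_ereal_def using assms by (simp cong: nn_integral_cong)

lemma risk_cong:
  assumes "\<And>x. x \<in> space M \<Longrightarrow> Y x = Y' x"
  shows "risk M \<sigma> Y = risk M \<sigma> Y'"
  unfolding risk_def by (intro SUP_cong refl expectation_ereal_cong) (simp add: assms)

lemma space_regular_cond_prob:
  assumes "regular_cond_prob \<Xi> T P t \<kappa>" "w \<in> topspace (path_space \<Xi> 1 t)"
  shows "space (\<kappa> w) = topspace (path_space \<Xi> (Suc t) T)"
proof -
  have "\<kappa> w \<in> space (prob_algebra (borel_of (path_space \<Xi> (Suc t) T)))"
    using assms unfolding regular_cond_prob_def by (intro measurable_space[of \<kappa>]) auto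
  then show ?thesis
    by (auto simp: space_prob_algebra dest: sets_eq_imp_space_eq)
qed

text \<open>
  The conditional law lives on genuine tails, so a conditional risk evaluates its argument only at
  genuine paths that continue \<open>x\<^bsub>1:t\<^esub>\<close>. Two different paths \<open>x\<close>, \<open>x'\<close> are allowed so that the same
  lemma also yields dependence on the prefix alone.
\<close>

lemma cond_risk_cong:
  assumes \<kappa>: "regular_cond_prob \<Xi> T P t (\<kappa> t)" and t: "t \<le> T"
    and x: "x \<in> topspace (path_space \<Xi> 1 T)"
    and eq: "restrict x {1..t} = restrict x' {1..t}"
    and Y: "\<And>y. y \<in> topspace (path_space \<Xi> 1 T) \<Longrightarrow> restrict y {1..t} = restrict x {1..t} \<Longrightarrow> Y y = Y' y"
  shows "cond_risk T \<kappa> S t Y x = cond_risk T \<kappa> S t Y' x'"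
proof -
  have paste_eq: "paste T t x' y = paste T t x y" for y
    by (rule paste_prefix_cong[OF eq[symmetric]])
  have "Y (paste T t x y) = Y' (paste T t x y)" if "y \<in> space (\<kappa> t (restrict x {1..t}))" for y
  proof (rule Y)
    have "y \<in> topspace (path_space \<Xi> (Suc t) T)"
      using that space_regular_cond_prob[OF \<kappa> restrict_path[OF x t]] by simp
    from paste_path[OF restrict_path[OF x t] this t]
    show "paste T t x y \<in> topspace (path_space \<Xi> 1 T)"
      by simp
  qed simp
  then have "risk (\<kappa> t (restrict x {1..t})) \<sigma> (\<lambda>y. Y (paste T t x y)) =
      risk (\<kappa> t (restrict x {1..t})) \<sigma> (\<lambda>y. Y' (paste T t x y))" for \<sigma>
    by (rule risk_cong)
  then show ?thesis
    by (simp only: cond_risk_def paste_eq eq[symmetric])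
qed

lemma nested_risk_self [simp]: "nested_risk T \<kappa> S t t Y = Y"
  by (simp add: nested_risk_def)

lemma nested_risk_rec:
  assumes "s < t"
  shows "nested_risk T \<kappa> S s t Y = cond_risk T \<kappa> S s (nested_risk T \<kappa> S (Suc s) t Y)"
  using assms by (simp add: nested_risk_def upt_conv_Cons)

text \<open>
  Downward induction on \<open>t\<close>: a path that agrees with \<open>y\<close> up to \<open>t+1\<close>, where \<open>y\<close> agrees with
  \<open>x\<close> up to \<open>t\<close>, itself agrees with \<open>x\<close> up to \<open>t\<close>, so the inner risks see no further paths.
\<close>

lemma nested_risk_cong:
  assumes "\<And>t. t < T \<Longrightarrow> regular_cond_prob \<Xi> T P t (\<kappa> t)" "t \<le> T"
    and "x \<in> topspace (path_space \<Xi> 1 T)"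
    and "\<And>y. y \<in> topspace (path_space \<Xi> 1 T) \<Longrightarrow> restrict y {1..t} = restrict x {1..t} \<Longrightarrow> Y y = Y' y"
  shows "nested_risk T \<kappa> S t T Y x = nested_risk T \<kappa> S t T Y' x"
  using assms(2-)
proof (induction arbitrary: x rule: inc_induct)
  case base
  then show ?case by simp
next
  case (step t)
  have "nested_risk T \<kappa> S (Suc t) T Y y = nested_risk T \<kappa> S (Suc t) T Y' y"
    if y: "y \<in> topspace (path_space \<Xi> 1 T)" "restrict y {1..t} = restrict x {1..t}" for y
  proof (rule step.IH[OF y(1)])
    fix y' assume y': "y' \<in> topspace (path_space \<Xi> 1 T)" "restrict y' {1..Suc t} = restrict y {1..Suc t}"
    from restrict_prefix_mono[OF y'(2), of t] y(2) have "restrict y' {1..t} = restrict x {1..t}"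
      by simp
    from step.prems(2)[OF y'(1) this] show "Y y' = Y' y'" .
  qed
  from cond_risk_cong[where \<kappa>=\<kappa> and t=t, OF assms(1)[OF step.hyps(2)] less_imp_le[OF step.hyps(2)] step.prems(1) refl this]
  show ?case
    unfolding nested_risk_rec[OF step.hyps(2)] .
qed

lemma nested_risk_prefix:
  assumes "\<And>t. t < T \<Longrightarrow> regular_cond_prob \<Xi> T P t (\<kappa> t)" "t \<le> T"
    and "x \<in> topspace (path_space \<Xi> 1 T)" "x' \<in> topspace (path_space \<Xi> 1 T)"
    and "restrict x {1..t} = restrict x' {1..t}"
  shows "nested_risk T \<kappa> S t T Y x = nested_risk T \<kappa> S t T Y x'"
proof (cases "t = T")
  case True
  have "restrict u {1..T} = u" if "u \<in> topspace (path_space \<Xi> 1 T)" for u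
    using that by (auto simp: topspace_path_space PiE_iff intro: extensional_restrict)
  from this[OF assms(3)] this[OF assms(4)] have "x = x'"
    using assms(5) unfolding True by metis
  then show ?thesis by simp
next
  case False
  with assms(2) have "t < T" by simp
  show ?thesis
    unfolding nested_risk_rec[OF \<open>t < T\<close>]
    by (rule cond_risk_cong[where \<kappa>=\<kappa> and t=t, OF assms(1)[OF \<open>t < T\<close>] assms(2,3,5)]) (rule refl)
qed

section \<open>The value process as nested risk of one random variable\<close>

lemma frozen_cost_eq_policy_cost:
  assumes "adapted_policy \<Xi> \<Z> T z" "t \<le> T"
    and "x \<in> topspace (path_space \<Xi> 1 T)" "y \<in> topspace (path_space \<Xi> 1 T)"
    and eq: "restrict y {1..t} = restrict x {1..t}"
  shows "frozen_cost T Q z t x y = policy_cost T Q z y"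
proof -
  have "paste T t x y = paste T t y y"
    by (rule paste_prefix_cong[OF eq[symmetric]])
  also have "\<dots> = y"
    by (rule paste_self[OF assms(4,2)])
  finally have paste: "paste T t x y = y" .
  have "z s x = z s y" if "s \<le> t" for s
    using assms restrict_prefix_mono[OF eq that] that unfolding adapted_policy_def
    by (metis order_trans)
  then have "(\<lambda>s\<in>{0..T}. if s \<le> t then z s x else z s y) = (\<lambda>s\<in>{0..T}. z s y)"
    by auto
  then show ?thesis
    unfolding frozen_cost_def policy_cost_def paste by simp
qed

lemma value_process_eq_nested_risk:
  assumes "\<And>t. t < T \<Longrightarrow> regular_cond_prob \<Xi> T P t (\<kappa> t)" "adapted_policy \<Xi> \<Z> T z" "t \<le> T"
    and "x \<in> topspace (path_space \<Xi> 1 T)"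
  shows "value_process T \<kappa> S Q z t x = nested_risk T \<kappa> S t T (policy_cost T Q z) x"
  unfolding value_process_def
  using nested_risk_cong[OF assms(1,3,4) frozen_cost_eq_policy_cost[OF assms(2-4)]] .

theorem theorem42:
  fixes T :: nat
    and \<Xi> :: "nat \<Rightarrow> 'a topology"
    and \<Z> :: "nat \<Rightarrow> 'z topology"
    and P :: "(nat \<Rightarrow> 'a) measure"
    and \<kappa> :: "nat \<Rightarrow> (nat \<Rightarrow> 'a) \<Rightarrow> (nat \<Rightarrow> 'a) measure"
    and S :: "nat \<Rightarrow> (real \<Rightarrow> real) set"
    and Q :: "(nat \<Rightarrow> 'z) \<Rightarrow> (nat \<Rightarrow> 'a) \<Rightarrow> ereal"
    and z :: "nat \<Rightarrow> (nat \<Rightarrow> 'a) \<Rightarrow> 'z"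
  assumes "T \<ge> 1"
    and "\<And>t. t \<in> {1..T} \<Longrightarrow> Polish_space (\<Xi> t)"
    and "prob_space P" and "sets P = sets (borel_of (path_space \<Xi> 1 T))"
    and "\<And>t. t < T \<Longrightarrow> regular_cond_prob \<Xi> T P t (\<kappa> t)"
    and "\<And>t \<sigma>. t \<in> {1..T} \<Longrightarrow> \<sigma> \<in> S t \<Longrightarrow> distortion \<sigma>"
    and "lower_semicontinuous_on_top (prod_topology (product_topology \<Z> {0..T}) (path_space \<Xi> 1 T))
           (\<lambda>(d, x). Q d x)"
    and "\<And>d x. d \<in> topspace (product_topology \<Z> {0..T}) \<Longrightarrow> x \<in> topspace (path_space \<Xi> 1 T) \<Longrightarrow>
           Q d x \<noteq> -\<infinity>"
    and "adapted_policy \<Xi> \<Z> T z"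
    and "nested_risk_well_defined \<Xi> T P \<kappa> S 0 T (policy_cost T Q z)"
  shows "risk_martingale \<Xi> T P \<kappa> S (value_process T \<kappa> S Q z) \<and>
         (\<forall>x \<in> topspace (path_space \<Xi> 1 T). value_process T \<kappa> S Q z T x = Q (\<lambda>s\<in>{0..T}. z s x) x)"
proof -
  let ?\<Omega> = "topspace (path_space \<Xi> 1 T)"
  let ?N = "\<lambda>t. nested_risk T \<kappa> S t T (policy_cost T Q z)"
  have v: "value_process T \<kappa> S Q z t x = ?N t x" if "t \<le> T" "x \<in> ?\<Omega>" for t x
    using value_process_eq_nested_risk[OF assms(5,9)] that by blast
  have spaceP: "space P = ?\<Omega>"
    using sets_eq_imp_space_eq[OF assms(4)] by simp
  have "value_process T \<kappa> S Q z t \<in> borel_measurable (history \<Xi> T t)" if t: "t \<le> T" for t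
  proof -
    note prefix = nested_risk_prefix[OF assms(5) t]
    have "?N t \<in> borel_measurable (history \<Xi> T t)"
    proof (rule measurable_history_of_prefix[OF _ t])
      show "?N t \<in> borel_measurable (borel_of (path_space \<Xi> 1 T))"
      proof (cases t)
        case 0
        \<comment> \<open>All paths share the empty prefix, so the outermost risk is a constant.\<close>
        have "?N t x = ?N t (SOME a. a \<in> ?\<Omega>)" if "x \<in> ?\<Omega>" for x
          by (rule prefix[OF _ that someI[of "\<lambda>a. a \<in> ?\<Omega>", OF that]]) (simp_all add: 0 fun_eq_iff)
        then show ?thesis
          by (subst measurable_cong[where g="\<lambda>_. ?N t (SOME a. a \<in> ?\<Omega>)"]) auto
      next
        case (Suc r)
        then show ?thesis
          using assms(10) t unfolding nested_risk_well_defined_def by auto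
      qed
    qed (use prefix in blast)
    then show ?thesis
      by (subst measurable_cong[where g="?N t"]) (auto simp: v[OF t] history_def)
  qed
  moreover have "value_process T \<kappa> S Q z t x =
      cond_risk T \<kappa> S t (value_process T \<kappa> S Q z (Suc t)) x" if t: "t < T" and x: "x \<in> ?\<Omega>" for t x
  proof -
    have "?N t x = cond_risk T \<kappa> S t (?N (Suc t)) x"
      by (simp add: nested_risk_rec[OF t])
    also have "\<dots> = cond_risk T \<kappa> S t (value_process T \<kappa> S Q z (Suc t)) x"
      using t by (intro cond_risk_cong[where \<kappa>=\<kappa> and t=t, OF assms(5)[OF t] _ x]) (simp_all add: v)
    finally show ?thesis
      using v x t by simp
  qed
  ultimately have "risk_martingale \<Xi> T P \<kappa> S (value_process T \<kappa> S Q z)"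
    unfolding risk_martingale_def by (auto simp: spaceP intro!: AE_I2)
  moreover have "value_process T \<kappa> S Q z T x = Q (\<lambda>s\<in>{0..T}. z s x) x" if "x \<in> ?\<Omega>" for x
    using v[OF order_refl that] by (simp add: policy_cost_def)
  ultimately show ?thesis by blast
qed

end
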